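(* Let $\upsilon\in\{1,2,\dots\}$, $q>-1$, $p$ real, and let $S$ be a nonnegative integer with $S<p-1$. Then for all $s,k\in\{0,1,\dots,S\}$, $$\int_{-\infty}^{\infty}\int_{0}^{\infty}{}_{K}I_{k;\upsilon}^{(p,q)}(z,t)\;{}_{K}\mathcal{I}_{s;\upsilon}^{(p,q)}(z,t)\,e^{-t}t^{q}(1+z^{2})^{-(p-1/2)}\,dt\,dz=\frac{k!\,2^{2(p-1)}\,\Gamma^{2}(p)}{(p-k-1)\,\Gamma(2p-k-1)}\,\delta_{k,s}.$$
   Context: $(a)_n$ is the Pochhammer symbol $(a)_n=a(a+1)\cdots(a+n-1)$, $(a)_0=1$; $[x]$ is the integer part; $\delta_{k,s}$ is the Kronecker delta. The finite bivariate I-Konhauser polynomials are $${}_{K}I_{k;\upsilon}^{(p,q)}(z,t)=(-1)^{k}(1-p)_{k}\sum_{l=0}^{[k/2]}\sum_{n=0}^{k-l}\frac{(-1)^{l}(-k)_{2l}(l-k)_{n}(2z)^{k-2l}t^{\upsilon n}}{(p-k)_{l}\,\Gamma(\upsilon n+q+1)\,n!\,l!}.$$ The second set is $${}_{K}\mathcal{I}_{s;\upsilon}^{(p,q)}(z,t)=I_{s}^{(p)}(z)\sum_{j=0}^{s}Y_{j}^{(q)}(t;\upsilon),$$ where $$I_{s}^{(p)}(z)=s!\sum_{l=0}^{[s/2]}\frac{(-1)^{l}\Gamma(p)(2z)^{s-2l}}{l!\,(s-2l)!\,\Gamma(p-s+l)}$$ and the Konhauser polynomials of the second set are $$Y_{j}^{(q)}(t;\upsilon)=\frac{1}{j!}\sum_{r=0}^{j}\frac{t^{r}}{r!}\sum_{m=0}^{r}(-1)^{m}\binom{r}{m}\left(\frac{1+q+m}{\upsilon}\right)_{j}.$$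 *)

theory Defs
  imports "HOL-Analysis.Analysis"
begin

text \<open>
  \<open>Gamma\<close> is set to \<open>0\<close> at its poles; for \<open>0 < \<upsilon>\<close>, \<open>- 1 < q\<close> and degrees below \<open>p - 1\<close> all its
  arguments below are positive. Likewise, in the summation ranges the natural-number subtractions
  used as exponents, factorial arguments and summation bounds do not truncate.
\<close>

definition konhauser_I_first :: "real \<Rightarrow> real \<Rightarrow> nat \<Rightarrow> nat \<Rightarrow> real \<Rightarrow> real \<Rightarrow> real" where
  "konhauser_I_first p q \<upsilon> k z t =
     (- 1) ^ k * pochhammer (1 - p) k *
     (\<Sum>l = 0..k div 2. \<Sum>n = 0..k - l.
        (- 1) ^ l * pochhammer (- real k) (2 * l) * pochhammer (real l - real k) n *
        (2 * z) ^ (k - 2 * l) * t ^ (\<upsilon> * n) /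
        (pochhammer (p - real k) l * Gamma (real \<upsilon> * real n + q + 1) * fact n * fact l))"

definition finite_I_poly :: "real \<Rightarrow> nat \<Rightarrow> real \<Rightarrow> real" where
  "finite_I_poly p s z =
     fact s * (\<Sum>l = 0..s div 2.
        (- 1) ^ l * Gamma p * (2 * z) ^ (s - 2 * l) /
        (fact l * fact (s - 2 * l) * Gamma (p - real s + real l)))"

definition konhauser_Y :: "real \<Rightarrow> nat \<Rightarrow> nat \<Rightarrow> real \<Rightarrow> real" where
  "konhauser_Y q \<upsilon> j t =
     1 / fact j * (\<Sum>r = 0..j. t ^ r / fact r *
        (\<Sum>m = 0..r. (- 1) ^ m * real (r choose m) *
           pochhammer ((1 + q + real m) / real \<upsilon>) j))"

definition konhauser_I_second :: "real \<Rightarrow> real \<Rightarrow> nat \<Rightarrow> nat \<Rightarrow> real \<Rightarrow> real \<Rightarrow> real" where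
  "konhauser_I_second p q \<upsilon> s z t = finite_I_poly p s z * (\<Sum>j = 0..s. konhauser_Y q \<upsilon> j t)"

end

theory Submission
  imports Defs
begin

text \<open>
  Both families are built from univariate ones. The first set is the sum over \<open>l\<close> of
  \<open>a\<^sub>l * z ^ (k - 2 * l) * Z (k - l) t\<close>, where the \<open>a\<^sub>l\<close> are the coefficients of the univariate finite
  polynomial \<open>I\<^sub>k\<close> and \<open>Z m\<close> is the Konhauser polynomial of the first set, normalized so that its
  pairing with \<open>Y\<^sub>j\<close> under the weight
  \<open>exp (- t) * t powr q\<close> is \<open>1\<close> if \<open>m = j\<close> and \<open>0\<close> otherwise (\<open>konhauser_I_first_eq_sum\<close>,
  \<open>konhauser_biorthonormality\<close>). The second set is \<open>I\<^sub>s\<close> times the sum of all \<open>Y\<^sub>j\<close> with \<open>j \<le> s\<close>.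
  Integrating over \<open>t\<close> hence keeps exactly the terms with \<open>k - l \<le> s\<close>. In such a term the power of \<open>z\<close>
  is \<open>k - 2l \<le> s - l\<close>, so it is below \<open>s\<close> unless \<open>l = 0\<close> and \<open>k = s\<close>. As \<open>I\<^sub>s\<close> is orthogonal to all lower
  powers of \<open>z\<close>, the integral over \<open>z\<close> is \<open>0\<close> for \<open>k \<noteq> s\<close>, and for \<open>k = s\<close> it is the leading
  coefficient of \<open>I\<^sub>k\<close> times its \<open>k\<close>-th moment.

  The Konhauser biorthogonality is finite difference calculus. The moments of \<open>Y\<^sub>j\<close> turn its defining
  double sum into the Newton expansion of a Pochhammer symbol, evaluated at a negative argument
  (\<open>konhauser_Y_moment\<close>, \<open>newton_forward_expansion\<close>), and the remaining sum is a binomial inversion.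

  The moments of \<open>I\<^sub>s\<close> (\<open>finite_I_moment\<close>) come from integration by parts: the derivative of \<open>I\<^sub>s\<close> times
  its weight is a multiple of the weighted polynomial with degree and parameter raised by one
  (\<open>weighted_finite_I_poly_derivative\<close>). Repeating this reduces every moment of order at most \<open>s\<close> to zero or to the
  integral of a power of \<open>1 + z\<^sup>2\<close>, which is a Beta integral (\<open>symmetric_cauchy_weight_integral\<close>).
\<close>

section \<open>Newton expansion and binomial inversion\<close>

text \<open>
  Binomial inversion: the identity \<open>(r choose i) * (i choose d) = (r choose d) * (r - d choose i - d)\<close>
  reduces the sum to the expansion of \<open>(1 - 1) ^ (r - d)\<close>.
\<close>

lemma alternating_binomial_orthogonality:
  "(\<Sum>i\<le>r. (- 1) ^ i * real (r choose i) * real (i choose d)) = (if r = d then (- 1) ^ d else 0)"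
proof (cases "d \<le> r")
  case False
  then have "(\<Sum>i\<le>r. (- 1) ^ i * real (r choose i) * real (i choose d)) = 0"
    by (intro sum.neutral) auto
  then show ?thesis
    using False by auto
next
  case True
  have "(\<Sum>i\<le>r. (- 1) ^ i * real (r choose i) * real (i choose d)) =
        (\<Sum>i=d..r. (- 1) ^ i * real (r choose i) * real (i choose d))"
    by (intro sum.mono_neutral_right) auto
  also have "\<dots> = (\<Sum>i=d..r. (- 1) ^ i * (real (r choose d) * real ((r - d) choose (i - d))))"
  proof (intro sum.cong refl)
    fix i assume "i \<in> {d..r}"
    then have "(r choose i) * (i choose d) = (r choose d) * ((r - d) choose (i - d))"
      by (intro choose_mult) auto
    then have "real (r choose i) * real (i choose d) = real (r choose d) * real ((r - d) choose (i - d))"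
      by (metis of_nat_mult)
    then show "(- 1) ^ i * real (r choose i) * real (i choose d) =
        (- 1) ^ i * (real (r choose d) * real ((r - d) choose (i - d)))"
      by simp
  qed
  also have "\<dots> = (\<Sum>i\<le>r - d. (- 1) ^ (i + d) * (real (r choose d) * real ((r - d) choose i)))"
    by (rule sum.reindex_bij_witness[of _ "\<lambda>i. i + d" "\<lambda>i. i - d"]) (use True in auto)
  also have "\<dots> = (- 1) ^ d * real (r choose d) * (\<Sum>i\<le>r - d. (- 1) ^ i * real ((r - d) choose i))"
    by (simp add: sum_distrib_left power_add mult_ac)
  also have "\<dots> = (if r = d then (- 1) ^ d else 0)"
    using True choose_alternating_sum[of "r - d", where ?'a = real] by auto
  finally show ?thesis .
qed

text \<open>
  Up to the sign \<open>(- 1) ^ r\<close>, the inner sum is the \<open>r\<close>-th forward difference of \<open>f\<close> at \<open>0\<close>;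
  by binomial inversion it picks out the coefficient \<open>c r\<close>. The point is that \<open>f\<close> is sampled only at
  natural numbers, whereas the expansion holds at every real \<open>x\<close>, in particular at negative ones.
\<close>

lemma newton_forward_expansion:
  fixes f :: "real \<Rightarrow> real"
  assumes f: "\<And>x. f x = (\<Sum>d\<le>j. c d * (x gchoose d))"
  shows "(\<Sum>r\<le>j. (- 1) ^ r * (x gchoose r) * (\<Sum>i\<le>r. (- 1) ^ i * real (r choose i) * f (real i))) = f x"
proof -
  have "(\<Sum>i\<le>r. (- 1) ^ i * real (r choose i) * f (real i)) = (- 1) ^ r * c r" if "r \<le> j" for r
  proof -
    have "(\<Sum>i\<le>r. (- 1) ^ i * real (r choose i) * f (real i)) =
          (\<Sum>i\<le>r. \<Sum>d\<le>j. c d * ((- 1) ^ i * real (r choose i) * real (i choose d)))"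
      by (simp add: f sum_distrib_left mult_ac binomial_gbinomial)
    also have "\<dots> = (\<Sum>d\<le>j. c d * (\<Sum>i\<le>r. (- 1) ^ i * real (r choose i) * real (i choose d)))"
      by (subst sum.swap) (simp add: sum_distrib_left)
    also have "\<dots> = (\<Sum>d\<le>j. if r = d then c d * (- 1) ^ d else 0)"
      unfolding alternating_binomial_orthogonality by (intro sum.cong) auto
    also have "\<dots> = (- 1) ^ r * c r"
      using that by simp
    finally show ?thesis .
  qed
  then have "(\<Sum>r\<le>j. (- 1) ^ r * (x gchoose r) * (\<Sum>i\<le>r. (- 1) ^ i * real (r choose i) * f (real i))) =
             (\<Sum>r\<le>j. (- 1) ^ r * (x gchoose r) * ((- 1) ^ r * c r))"
    by (intro sum.cong) auto
  also have "\<dots> = (\<Sum>r\<le>j. c r * (x gchoose r))"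
    by (intro sum.cong refl) (simp flip: power_mult_distrib add: mult.assoc mult.left_commute)
  finally show ?thesis
    by (simp add: f)
qed

text \<open>
  The Pochhammer symbol is a polynomial of degree at most \<open>j\<close> in \<open>x\<close>, and the binomials
  \<open>x gchoose d\<close> are a basis. Each new linear factor is absorbed by
  \<open>x * (x gchoose d) = d * (x gchoose d) + (d + 1) * (x gchoose (d + 1))\<close>.
\<close>

lemma pochhammer_affine_gbinomial_expansion:
  fixes a b :: real
  shows "\<exists>c. \<forall>x. pochhammer ((a + x) / b) j = (\<Sum>d\<le>j. c d * (x gchoose d))"
proof (induction j)
  case 0
  then show ?case
    by (intro exI[of _ "\<lambda>_. 1"]) simp
next
  case (Suc j)
  then obtain c where c: "\<And>x. pochhammer ((a + x) / b) j = (\<Sum>d\<le>j. c d * (x gchoose d))"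
    by blast
  \<comment> \<open>Each new factor is \<open>\<alpha> + x / b\<close>.\<close>
  define \<alpha> where "\<alpha> = a / b + real j"
  define c' where "c' e = (if e \<le> j then (\<alpha> + real e / b) * c e else 0) +
                          (if e = 0 then 0 else real e / b * c (e - 1))" for e
  have "pochhammer ((a + x) / b) (Suc j) = (\<Sum>d\<le>Suc j. c' d * (x gchoose d))" for x
  proof -
    have "pochhammer ((a + x) / b) (Suc j) = (\<Sum>d\<le>j. c d * (x gchoose d)) * (\<alpha> + x / b)"
      unfolding pochhammer_Suc c \<alpha>_def by (simp add: add_divide_distrib add_ac)
    also have "\<dots> = (\<Sum>d\<le>j. c d * (\<alpha> * (x gchoose d) + x * (x gchoose d) / b))"
      unfolding sum_distrib_right by (intro sum.cong refl) (simp add: distrib_left mult_ac)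
    also have "\<dots> = (\<Sum>d\<le>j. (\<alpha> + real d / b) * c d * (x gchoose d) +
                           real (Suc d) / b * c d * (x gchoose Suc d))"
    proof (intro sum.cong refl)
      fix d
      show "c d * (\<alpha> * (x gchoose d) + x * (x gchoose d) / b) =
        (\<alpha> + real d / b) * c d * (x gchoose d) + real (Suc d) / b * c d * (x gchoose Suc d)"
        unfolding gbinomial_mult_1 by (simp add: add_divide_distrib algebra_simps del: of_nat_Suc)
    qed
    also have "\<dots> = (\<Sum>d\<le>j. (\<alpha> + real d / b) * c d * (x gchoose d)) +
                    (\<Sum>d\<le>j. real (Suc d) / b * c d * (x gchoose Suc d))"
      by (rule sum.distrib)
    also have "(\<Sum>d\<le>j. (\<alpha> + real d / b) * c d * (x gchoose d)) =
               (\<Sum>d\<le>Suc j. (if d \<le> j then (\<alpha> + real d / b) * c d else 0) * (x gchoose d))"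
      by simp
    also have "(\<Sum>d\<le>j. real (Suc d) / b * c d * (x gchoose Suc d)) =
               (\<Sum>d\<le>Suc j. (if d = 0 then 0 else real d / b * c (d - 1)) * (x gchoose d))"
      by (subst sum.atMost_Suc_shift) simp
    finally show ?thesis
      by (simp only: c'_def distrib_right sum.distrib)
  qed
  then show ?case
    by blast
qed

section \<open>Biorthogonality of the Konhauser polynomials\<close>

lemma gamma_weight_moment:
  fixes q :: real
  assumes "q > - 1"
  shows "has_bochner_integral lborel (\<lambda>t. indicator {0<..} t * (t ^ n * exp (- t) * t powr q))
           (Gamma (real n + q + 1))"
proof (rule has_bochner_integral_nn_integral)
  have "(\<integral>\<^sup>+t. ennreal (indicator {0<..} t * (t ^ n * exp (- t) * t powr q)) \<partial>lborel) =
        (\<integral>\<^sup>+t. ennreal (indicator {0..} t * t powr (real n + q + 1 - 1) / exp t) \<partial>lborel)"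
  proof (rule nn_integral_cong)
    fix t :: real
    show "ennreal (indicator {0<..} t * (t ^ n * exp (- t) * t powr q)) =
          ennreal (indicator {0..} t * t powr (real n + q + 1 - 1) / exp t)"
      by (cases "t > 0") (auto simp: powr_add powr_realpow exp_minus field_simps indicator_def)
  qed
  also have "\<dots> = ennreal (Gamma (real n + q + 1))"
    using assms by (intro Gamma_conv_nn_integral_real[symmetric]) auto
  finally show "(\<integral>\<^sup>+t. ennreal (indicator {0<..} t * (t ^ n * exp (- t) * t powr q)) \<partial>lborel) =
        ennreal (Gamma (real n + q + 1))" .
  show "Gamma (real n + q + 1) \<ge> 0"
    using assms by (intro less_imp_le Gamma_real_pos) auto
qed (auto simp: indicator_def)

text \<open>
  Put \<open>a = \<upsilon> * n + q + 1\<close>. Integrating \<open>t ^ r / r!\<close> against the monomial and the weight gives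
  \<open>Gamma (a + r) / r! = Gamma a * (- 1) ^ r * ((- a) gchoose r)\<close>, so the integral of the defining double
  sum of \<open>Y\<close> is a Newton expansion evaluated at \<open>- a\<close>. The sampled function is
  \<open>x \<mapsto> pochhammer ((1 + q + x) / \<upsilon>) j\<close>, whose argument at \<open>- a\<close> is exactly \<open>- n\<close>.
\<close>

lemma konhauser_Y_moment:
  fixes q :: real
  assumes "q > - 1" and "\<upsilon> \<ge> 1"
  shows "has_bochner_integral lborel
           (\<lambda>t. indicator {0<..} t * (t ^ (\<upsilon> * n) * konhauser_Y q \<upsilon> j t * exp (- t) * t powr q))
           (Gamma (real \<upsilon> * real n + q + 1) * pochhammer (- real n) j / fact j)"
proof -
  define a where "a = real \<upsilon> * real n + q + 1"
  have a: "a > 0"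
    unfolding a_def using assms(1) mult_nonneg_nonneg[OF of_nat_0_le_iff[of \<upsilon>, where 'a = real] of_nat_0_le_iff[of n]]
    by linarith
  define f where "f x = pochhammer ((1 + q + x) / real \<upsilon>) j" for x
  define D where "D r = (\<Sum>m\<le>r. (- 1) ^ m * real (r choose m) * f (real m))" for r
  have Y: "konhauser_Y q \<upsilon> j t = (\<Sum>r\<le>j. D r / (fact j * fact r) * t ^ r)" for t
    unfolding konhauser_Y_def D_def f_def atLeast0AtMost sum_distrib_left[of "1 / fact j"]
    by (intro sum.cong refl) (simp add: mult_ac)
  have *: "indicator {0<..} t * (t ^ (\<upsilon> * n) * konhauser_Y q \<upsilon> j t * exp (- t) * t powr q) =
           (\<Sum>r\<le>j. D r / (fact j * fact r) *
                   (indicator {0<..} t * (t ^ (\<upsilon> * n + r) * exp (- t) * t powr q)))" for t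
    unfolding Y by (simp add: sum_distrib_left sum_distrib_right power_add mult_ac)
  have "has_bochner_integral lborel
          (\<lambda>t. \<Sum>r\<le>j. D r / (fact j * fact r) *
                   (indicator {0<..} t * (t ^ (\<upsilon> * n + r) * exp (- t) * t powr q)))
          (\<Sum>r\<le>j. D r / (fact j * fact r) * Gamma (real (\<upsilon> * n + r) + q + 1))"
    using assms by (intro has_bochner_integral_sum has_bochner_integral_mult_right gamma_weight_moment) auto
  also have "(\<Sum>r\<le>j. D r / (fact j * fact r) * Gamma (real (\<upsilon> * n + r) + q + 1)) =
             Gamma a / fact j * (\<Sum>r\<le>j. (- 1) ^ r * ((- a) gchoose r) * D r)"
  proof -
    have "Gamma (real (\<upsilon> * n + r) + q + 1) / fact r = Gamma a * ((- 1) ^ r * ((- a) gchoose r))" for r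
    proof -
      have "a \<notin> \<int>\<^sub>\<le>\<^sub>0"
        using a by (auto elim!: nonpos_Ints_cases)
      then have "pochhammer a r = Gamma (a + real r) / Gamma a"
        by (rule pochhammer_Gamma)
      moreover have "Gamma a > 0"
        using a by simp
      ultimately have "Gamma (real (\<upsilon> * n + r) + q + 1) = Gamma a * pochhammer a r"
        by (simp add: a_def add_ac)
      then show ?thesis
        by (simp add: gbinomial_pochhammer flip: power_mult_distrib)
    qed
    note G = this
    have "D r / (fact j * fact r) * Gamma (real (\<upsilon> * n + r) + q + 1) =
          Gamma a / fact j * ((- 1) ^ r * ((- a) gchoose r) * D r)" for r
    proof -
      have "D r / (fact j * fact r) * Gamma (real (\<upsilon> * n + r) + q + 1) =
            D r / fact j * (Gamma (real (\<upsilon> * n + r) + q + 1) / fact r)"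
        by simp
      also have "\<dots> = Gamma a / fact j * ((- 1) ^ r * ((- a) gchoose r) * D r)"
        unfolding G by simp
      finally show ?thesis .
    qed
    then show ?thesis
      by (simp add: sum_distrib_left)
  qed
  also have "(\<Sum>r\<le>j. (- 1) ^ r * ((- a) gchoose r) * D r) = f (- a)"
  proof -
    obtain c where "\<And>x. f x = (\<Sum>d\<le>j. c d * (x gchoose d))"
      using pochhammer_affine_gbinomial_expansion[of "1 + q" "real \<upsilon>" j] unfolding f_def by blast
    then show ?thesis
      unfolding D_def by (rule newton_forward_expansion)
  qed
  also have "f (- a) = pochhammer (- real n) j"
    using assms by (simp add: f_def a_def)
  finally show ?thesis
    by (simp only: *) (simp add: a_def)
qed

text \<open>
  The Konhauser polynomial of the first set, divided by \<open>Gamma (\<upsilon> * m + q + 1) / m!\<close>. With this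
  normalization the pairing with \<open>Y\<close> is orthonormal, and the inner sum in the definition of the
  bivariate polynomials is this function with \<open>m = k - l\<close>.
\<close>

definition konhauser_Z :: "real \<Rightarrow> nat \<Rightarrow> nat \<Rightarrow> real \<Rightarrow> real" where
  "konhauser_Z q \<upsilon> m t =
     (\<Sum>n\<le>m. pochhammer (- real m) n / (Gamma (real \<upsilon> * real n + q + 1) * fact n) * t ^ (\<upsilon> * n))"

lemma pochhammer_minus_nat_div_fact:
  "pochhammer (- real m) n / fact n = (- 1) ^ n * real (m choose n)"
  by (simp add: binomial_gbinomial gbinomial_pochhammer flip: power_mult_distrib)

text \<open>
  The factor \<open>Gamma (\<upsilon> * n + q + 1)\<close> in the moments of \<open>Y\<close> cancels the one in \<open>Z\<close>. What remains is
  \<open>(- 1) ^ j\<close> times the alternating sum of \<open>(m choose n) * (n choose j)\<close>, evaluated by binomial inversion.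
\<close>

lemma konhauser_biorthonormality:
  fixes q :: real
  assumes "q > - 1" and "\<upsilon> \<ge> 1"
  shows "has_bochner_integral lborel
           (\<lambda>t. indicator {0<..} t * (konhauser_Z q \<upsilon> m t * konhauser_Y q \<upsilon> j t * exp (- t) * t powr q))
           (if m = j then 1 else 0)"
proof -
  define g where "g n = Gamma (real \<upsilon> * real n + q + 1)" for n :: nat
  have g: "g n > 0" for n
    unfolding g_def using assms(1) mult_nonneg_nonneg[OF of_nat_0_le_iff[of \<upsilon>, where 'a = real] of_nat_0_le_iff[of n]]
    by (intro Gamma_real_pos) linarith
  have *: "indicator {0<..} t * (konhauser_Z q \<upsilon> m t * konhauser_Y q \<upsilon> j t * exp (- t) * t powr q) =
     (\<Sum>n\<le>m. pochhammer (- real m) n / (g n * fact n) *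
       (indicator {0<..} t * (t ^ (\<upsilon> * n) * konhauser_Y q \<upsilon> j t * exp (- t) * t powr q)))" for t
    unfolding konhauser_Z_def g_def
    by (simp add: sum_distrib_left sum_distrib_right mult_ac)
  have "has_bochner_integral lborel
     (\<lambda>t. \<Sum>n\<le>m. pochhammer (- real m) n / (g n * fact n) *
       (indicator {0<..} t * (t ^ (\<upsilon> * n) * konhauser_Y q \<upsilon> j t * exp (- t) * t powr q)))
     (\<Sum>n\<le>m. pochhammer (- real m) n / (g n * fact n) * (g n * pochhammer (- real n) j / fact j))"
    unfolding g_def using assms
    by (intro has_bochner_integral_sum has_bochner_integral_mult_right konhauser_Y_moment) auto
  also have "(\<Sum>n\<le>m. pochhammer (- real m) n / (g n * fact n) * (g n * pochhammer (- real n) j / fact j)) =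
             (\<Sum>n\<le>m. pochhammer (- real m) n / fact n * (pochhammer (- real n) j / fact j))"
    using g by (intro sum.cong refl) (simp add: field_simps less_imp_neq[symmetric])
  also have "\<dots> = (- 1) ^ j * (\<Sum>n\<le>m. (- 1) ^ n * real (m choose n) * real (n choose j))"
    by (simp only: pochhammer_minus_nat_div_fact) (simp add: sum_distrib_left mult_ac)
  also have "\<dots> = (if m = j then 1 else 0)"
    unfolding alternating_binomial_orthogonality by (simp flip: power_mult_distrib)
  finally show ?thesis
    by (simp only: *)
qed

section \<open>Integrals against powers of \<open>1 + z\<^sup>2\<close>\<close>

text \<open>
  The substitution \<open>t = (1 + z / sqrt (1 + z\<^sup>2)) / 2\<close> maps the real line increasingly onto the open unit
  interval, with \<open>t * (1 - t) = 1 / (4 * (1 + z\<^sup>2))\<close>. A power of \<open>1 + z\<^sup>2\<close> therefore becomes a symmetric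
  Beta integrand.
\<close>

lemma symmetric_cauchy_weight_integral:
  fixes p :: real
  assumes "p > 1"
  shows "has_bochner_integral lborel (\<lambda>z. (1 + z\<^sup>2) powr (- (p - 1 / 2)))
           (2 powr (2 * p - 3) * Beta (p - 1) (p - 1))"
proof -
  define f where "f t = t powr (p - 1 - 1) * (1 - t) powr (p - 1 - 1)" for t :: real
  define g where "g z = (1 + z * (1 + z\<^sup>2) powr (- 1 / 2)) / 2" for z :: real
  define g' where "g' z = (1 + z\<^sup>2) powr (- 3 / 2) / 2" for z :: real
  have pos: "1 + z\<^sup>2 > 0" for z :: real
    by (intro add_pos_nonneg) auto
  have deriv: "(g has_field_derivative g' z) (at z within A)" for z A
  proof -
    have "(g has_field_derivative
            (1 * (1 + z\<^sup>2) powr (- 1 / 2) + (- 1 / 2 * (1 + z\<^sup>2) powr (- 1 / 2 - 1) * (2 * z)) * z) / 2)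
            (at z within A)"
      unfolding g_def using pos[of z]
      by (auto intro!: derivative_eq_intros simp: powr_diff)
    also have "1 * (1 + z\<^sup>2) powr (- 1 / 2) + (- 1 / 2 * (1 + z\<^sup>2) powr (- 1 / 2 - 1) * (2 * z)) * z =
               (1 + z\<^sup>2) powr (- 3 / 2)"
    proof -
      have "(1 + z\<^sup>2) powr (- 1 / 2) = (1 + z\<^sup>2) * (1 + z\<^sup>2) powr (- 3 / 2)"
        using pos[of z] powr_add[of "1 + z\<^sup>2" 1 "- 3 / 2"] by simp
      then show ?thesis
        by (simp add: algebra_simps power2_eq_square)
    qed
    finally show ?thesis
      by (simp add: g'_def)
  qed
  have g'_pos: "g' z > 0" for z
    using pos[of z] by (simp add: g'_def)
  have "strict_mono g"
    by (rule strict_monoI, rule DERIV_pos_imp_increasing) (use deriv g'_pos in blast)+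
  then have inj: "inj g"
    by (rule strict_mono_imp_inj_on)
  have g_mult: "g z * (1 - g z) = 1 / (4 * (1 + z\<^sup>2))" for z
  proof -
    have "((1 + z\<^sup>2) powr (- 1 / 2))\<^sup>2 = 1 / (1 + z\<^sup>2)"
      using pos[of z] by (simp add: powr_power powr_minus field_simps)
    then have "g z * (1 - g z) = (1 - z\<^sup>2 * (1 / (1 + z\<^sup>2))) / 4"
      by (simp add: g_def field_simps power2_eq_square)
    also have "\<dots> = 1 / (4 * (1 + z\<^sup>2))"
      using pos[of z] by (simp add: field_simps)
    finally show ?thesis .
  qed
  have g_range: "g z \<in> {0<..<1}" for z
  proof -
    have "g z * (1 - g z) > 0"
      unfolding g_mult using pos[of z] by simp
    then show ?thesis
      by (auto simp: zero_less_mult_iff)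
  qed
  have img: "g ` UNIV = {0<..<1}"
  proof (intro equalityI subsetI)
    fix t :: real assume t: "t \<in> {0<..<1}"
    define x where "x = 2 * t - 1"
    \<comment> \<open>With \<open>x = 2 * t - 1\<close> the equation \<open>g z = t\<close> reads \<open>z / sqrt (1 + z\<^sup>2) = x\<close>.\<close>
    define z where "z = x / sqrt (1 - x\<^sup>2)"
    have "1 - x\<^sup>2 = 4 * (t * (1 - t))"
      by (simp add: x_def power2_eq_square algebra_simps)
    then have x: "1 - x\<^sup>2 > 0"
      using t by simp
    have "1 + z\<^sup>2 = 1 / (1 - x\<^sup>2)"
      using x by (simp add: z_def power_divide field_simps)
    then have "(1 + z\<^sup>2) powr (- 1 / 2) = (1 / (1 - x\<^sup>2)) powr (- (1 / 2))"
      by simp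
    also have "\<dots> = sqrt (1 - x\<^sup>2)"
      using x by (simp only: powr_minus powr_half_sqrt divide_nonneg_pos zero_le_one)
        (simp add: real_sqrt_divide)
    finally have "(1 + z\<^sup>2) powr (- 1 / 2) = sqrt (1 - x\<^sup>2)" .
    then have "g z = t"
      using x by (simp add: g_def z_def x_def)
    then show "t \<in> range g"
      by blast
  qed (use g_range in blast)
  have "(f has_integral Beta (p - 1) (p - 1)) {0..1}"
    unfolding f_def using assms by (intro has_integral_Beta_real) auto
  then have f_int: "(f has_integral Beta (p - 1) (p - 1)) {0<..<1}"
    by (simp add: has_integral_Icc_iff_Ioo)
  then have "f absolutely_integrable_on {0<..<1}"
    by (intro nonnegative_absolutely_integrable_1) (auto simp: f_def has_integral_integrable)
  with f_int have "(\<lambda>z. \<bar>g' z\<bar> * f (g z)) absolutely_integrable_on UNIV \<and>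
                   integral UNIV (\<lambda>z. \<bar>g' z\<bar> * f (g z)) = Beta (p - 1) (p - 1)"
    using has_absolute_integral_change_of_variables_1'[of UNIV g g' f "Beta (p - 1) (p - 1)"]
      deriv inj by (auto simp: img integral_unique)
  moreover have "\<bar>g' z\<bar> * f (g z) = 2 powr (3 - 2 * p) * (1 + z\<^sup>2) powr (- (p - 1 / 2))" for z
  proof -
    have "f (g z) = (g z * (1 - g z)) powr (p - 2)"
      using g_range[of z] by (simp add: f_def powr_mult)
    also have "\<dots> = (1 / 4) powr (p - 2) * (1 + z\<^sup>2) powr (2 - p)"
    proof -
      have "1 / (4 * (1 + z\<^sup>2)) = 1 / 4 * (1 + z\<^sup>2) powr (- 1)"
        using pos[of z] by (simp add: powr_minus field_simps)
      then show ?thesis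
        unfolding g_mult by (simp only: powr_mult powr_powr) (simp add: algebra_simps)
    qed
    also have "(1 / 4 :: real) powr (p - 2) = 2 * 2 powr (3 - 2 * p)"
    proof -
      have "(1 / 4 :: real) powr (p - 2) = (2 powr (- 2)) powr (p - 2)"
        by (simp add: powr_minus)
      also have "\<dots> = 2 powr (1 + (3 - 2 * p))"
        unfolding powr_powr by (rule arg_cong[where f = "(powr) 2"]) simp
      finally have "(1 / 4 :: real) powr (p - 2) = 2 powr (1 + (3 - 2 * p))" .
      then show ?thesis
        by (simp only: powr_add) simp
    qed
    also have "\<bar>g' z\<bar> * (2 * 2 powr (3 - 2 * p) * (1 + z\<^sup>2) powr (2 - p)) =
               2 powr (3 - 2 * p) * ((1 + z\<^sup>2) powr (- 3 / 2) * (1 + z\<^sup>2) powr (2 - p))"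
      by (simp add: g'_def)
    also have "(1 + z\<^sup>2) powr (- 3 / 2) * (1 + z\<^sup>2) powr (2 - p) = (1 + z\<^sup>2) powr (- (p - 1 / 2))"
      by (simp flip: powr_add)
    finally show ?thesis .
  qed
  ultimately have *: "(\<lambda>z::real. 2 powr (3 - 2 * p) * (1 + z\<^sup>2) powr (- (p - 1 / 2))) absolutely_integrable_on UNIV"
    and **: "integral UNIV (\<lambda>z. 2 powr (3 - 2 * p) * (1 + z\<^sup>2) powr (- (p - 1 / 2))) = Beta (p - 1) (p - 1)"
    by simp_all
  have "integrable lborel (\<lambda>z::real. 2 powr (3 - 2 * p) * (1 + z\<^sup>2) powr (- (p - 1 / 2)))"
    using * unfolding set_integrable_def by (simp add: integrable_completion)
  moreover from this have "(LBINT z. 2 powr (3 - 2 * p) * (1 + z\<^sup>2) powr (- (p - 1 / 2))) = Beta (p - 1) (p - 1)"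
    using has_integral_integral_lborel ** by (metis integral_unique)
  ultimately have "has_bochner_integral lborel
      (\<lambda>z. 2 powr (2 * p - 3) * (2 powr (3 - 2 * p) * (1 + z\<^sup>2) powr (- (p - 1 / 2))))
      (2 powr (2 * p - 3) * Beta (p - 1) (p - 1))"
    by (intro has_bochner_integral_mult_right) (simp add: has_bochner_integral_iff)
  moreover have "(2::real) powr (2 * p - 3) * (2 powr (3 - 2 * p) * y) = y" for y
    by (simp flip: mult.assoc powr_add)
  ultimately show ?thesis
    by simp
qed

lemma power_times_weight_bound:
  "\<bar>z ^ n * (1 + z\<^sup>2) powr (- a)\<bar> \<le> (1 + z\<^sup>2) powr (real n / 2 - a)" for z a :: real
proof -
  have pos: "1 + z\<^sup>2 > 0"
    by (intro add_pos_nonneg) auto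
  have "\<bar>z\<bar> \<le> sqrt (1 + z\<^sup>2)"
    by (rule real_le_rsqrt) simp
  then have "\<bar>z\<bar> ^ n \<le> sqrt (1 + z\<^sup>2) ^ n"
    by (intro power_mono) auto
  also have "\<dots> = (1 + z\<^sup>2) powr (real n / 2)"
    using pos by (simp add: powr_half_sqrt[symmetric] powr_power)
  finally have "\<bar>z\<bar> ^ n * (1 + z\<^sup>2) powr (- a) \<le> (1 + z\<^sup>2) powr (real n / 2) * (1 + z\<^sup>2) powr (- a)"
    by (intro mult_right_mono) auto
  then show ?thesis
    by (simp add: abs_mult power_abs flip: powr_add)
qed

lemma integrable_power_times_weight:
  fixes p :: real
  assumes "real n < 2 * (p - 1)"
  shows "integrable lborel (\<lambda>z. z ^ n * (1 + z\<^sup>2) powr (- (p - 1 / 2)))"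
proof (rule Bochner_Integration.integrable_bound)
  show "integrable lborel (\<lambda>z. (1 + z\<^sup>2) powr (- ((p - real n / 2) - 1 / 2)))"
    using symmetric_cauchy_weight_integral[of "p - real n / 2"] assms
    by (simp add: has_bochner_integral_iff)
  show "AE z in lborel. norm (z ^ n * (1 + z\<^sup>2) powr (- (p - 1 / 2)))
          \<le> norm ((1 + z\<^sup>2) powr (- ((p - real n / 2) - 1 / 2)))"
    using power_times_weight_bound[of _ n "p - 1 / 2"]
    by (auto intro!: AE_I2 simp: algebra_simps)
qed auto

lemma tendsto_power_times_weight:
  fixes p :: real
  assumes "real n < 2 * p - 1" and F: "F = at_top \<or> F = at_bot"
  shows "((\<lambda>z. z ^ n * (1 + z\<^sup>2) powr (- (p - 1 / 2))) \<longlongrightarrow> 0) F"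
proof (rule tendsto_0_le)
  have "filterlim (\<lambda>z::real. z\<^sup>2) at_top F"
    using F filterlim_pow_at_top[of 2 "\<lambda>z. z" at_top] filterlim_pow_at_bot_even[of 2 "\<lambda>z. z" at_bot]
    by (auto simp: filterlim_ident)
  then have "filterlim (\<lambda>z::real. 1 + z\<^sup>2) at_top F"
    by (intro filterlim_tendsto_add_at_top[OF tendsto_const])
  then show "((\<lambda>z::real. (1 + z\<^sup>2) powr (real n / 2 - (p - 1 / 2))) \<longlongrightarrow> 0) F"
    using assms by (intro tendsto_neg_powr) auto
  show "\<forall>\<^sub>F z in F. norm (z ^ n * (1 + z\<^sup>2) powr (- (p - 1 / 2)))
          \<le> norm ((1 + z\<^sup>2) powr (real n / 2 - (p - 1 / 2))) * 1"
    using power_times_weight_bound[of _ n "p - 1 / 2"] by (intro always_eventually) auto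
qed

text \<open>
  This is how integration by parts is used: the integrand is the derivative of a product that vanishes
  at both ends of the line, so there is no boundary term.
\<close>

lemma integral_derivative_vanishing_at_infinity:
  fixes F f :: "real \<Rightarrow> real"
  assumes "\<And>x. (F has_real_derivative f x) (at x)" and "continuous_on UNIV f"
    and "integrable lborel f" and "(F \<longlongrightarrow> 0) at_top" and "(F \<longlongrightarrow> 0) at_bot"
  shows "(LBINT x. f x) = 0"
proof -
  have "(LBINT x=-\<infinity>..\<infinity>. f x) = 0 - 0"
  proof (rule interval_integral_FTC_integrable)
    show "((F \<circ> real_of_ereal) \<longlongrightarrow> 0) (at_right (-\<infinity>))" "((F \<circ> real_of_ereal) \<longlongrightarrow> 0) (at_left \<infinity>)"
      using assms(4,5) by (simp_all add: at_left_PInf at_right_MInf filterlim_filtermap)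
    show "set_integrable lborel (einterval (-\<infinity>) \<infinity>) f"
      using assms(3) by (simp add: set_integrable_def)
  qed (use assms(1,2) in \<open>auto simp: has_real_derivative_iff_has_vector_derivative continuous_on_eq_continuous_at\<close>)
  then show ?thesis
    by (simp add: interval_lebesgue_integral_def set_lebesgue_integral_def)
qed

section \<open>Moments of the finite polynomials\<close>

lemma Gamma_plus1_pos: "Gamma (x + 1) = x * Gamma x" if "x > 0" for x :: real
  using that by (intro Gamma_plus1) (auto elim!: nonpos_Ints_cases)

text \<open>
  The value \<open>0\<close> for \<open>2 * l > s\<close> allows sums over \<open>l \<le> s\<close>, or any larger range, so that index shifts
  need no distinction between even and odd degrees.
\<close>

definition finite_I_coeff :: "real \<Rightarrow> nat \<Rightarrow> nat \<Rightarrow> real" where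
  "finite_I_coeff p s l =
     (if 2 * l \<le> s
      then fact s * (- 1) ^ l * Gamma p * 2 ^ (s - 2 * l) /
           (fact l * fact (s - 2 * l) * Gamma (p - real s + real l))
      else 0)"

lemma finite_I_poly_eq_sum:
  "finite_I_poly p s z = (\<Sum>l\<le>s. finite_I_coeff p s l * z ^ (s - 2 * l))"
proof -
  have "finite_I_poly p s z = (\<Sum>l=0..s div 2. finite_I_coeff p s l * z ^ (s - 2 * l))"
    unfolding finite_I_poly_def sum_distrib_left
    by (intro sum.cong refl) (auto simp: finite_I_coeff_def power_mult_distrib)
  also have "\<dots> = (\<Sum>l\<le>s. finite_I_coeff p s l * z ^ (s - 2 * l))"
    by (intro sum.mono_neutral_left) (auto simp: finite_I_coeff_def)
  finally show ?thesis .
qed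

text \<open>
  Comparison of the coefficients of \<open>z ^ (s + 1 - 2 * l)\<close> in \<open>finite_I_poly_raising\<close>. With
  \<open>m = s + 1 - 2 * l\<close>, all three coefficients are multiples of the same quantity \<open>A\<close>, and the claim becomes
  a polynomial identity in \<open>m\<close>, \<open>l\<close> and \<open>p\<close>.
\<close>

lemma finite_I_coeff_recurrence:
  assumes "real s < p - 1"
  shows "finite_I_coeff p s l * (real (s - 2 * l) - (2 * p - 1)) +
           (if l = 0 then 0 else finite_I_coeff p s (l - 1) * real (s - 2 * (l - 1))) =
         (real s + 1 - 2 * p) / (2 * p) * finite_I_coeff (p + 1) (Suc s) l"
proof (cases "2 * l \<le> Suc s")
  case False
  then show ?thesis
    by (cases "2 * l = s + 2") (auto simp: finite_I_coeff_def)
next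
  case True
  then obtain m where m: "Suc s = m + 2 * l"
    by (metis add.commute le_iff_add)
  have s: "real s = real m + 2 * real l - 1"
    using arg_cong[OF m, of real] by simp
  have p: "p > 0" "Gamma p > 0" "p - real s + real l > 1" "Gamma (p - real s + real l) > 0"
    using assms by (auto intro!: Gamma_real_pos)
  define A where "A = (- 1) ^ l * fact s * Gamma p * 2 ^ m / (fact l * fact m * Gamma (p - real s + real l))"
  have upper: "finite_I_coeff (p + 1) (Suc s) l = A * (real s + 1) * p"
  proof -
    have "Gamma (p + 1) = p * Gamma p"
      using p by (intro Gamma_plus1_pos)
    moreover have "Suc s - 2 * l = m"
      using m by simp
    ultimately show ?thesis
      using True unfolding finite_I_coeff_def A_def by (simp add: algebra_simps)
  qed
  have same: "finite_I_coeff p s l * (real (s - 2 * l) - (2 * p - 1)) = A * (real m / 2) * (real m - 2 * p)"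
  proof (cases m)
    case 0
    then show ?thesis
      using m by (simp add: finite_I_coeff_def)
  next
    case (Suc m')
    then have s_eq: "s - 2 * l = m'" and le: "2 * l \<le> s" and "real m > 0" and m': "real m' = real m - 1"
      using m by simp_all
    have "A = (- 1) ^ l * fact s * Gamma p * (2 * 2 ^ m') /
              (fact l * (real m * fact m') * Gamma (p - real s + real l))"
      by (simp add: A_def Suc)
    then have "finite_I_coeff p s l = A * (real m / 2)"
      using le p \<open>real m > 0\<close> by (simp add: finite_I_coeff_def s_eq) (simp add: mult_ac)
    then show ?thesis
      by (simp add: s_eq m')
  qed
  have previous: "(if l = 0 then 0 else finite_I_coeff p s (l - 1) * real (s - 2 * (l - 1))) =
                  - A * 2 * real l * (p - real s + real l - 1)"
  proof (cases l)
    case 0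
    then show ?thesis by simp
  next
    case (Suc l')
    have e: "s - 2 * l' = Suc m" and le: "2 * l' \<le> s"
      using m Suc by auto
    define x where "x = p - real s + real l'"
    have x: "x > 0" "Gamma x > 0"
      using p(3) Suc by (auto simp: x_def)
    have "Gamma (x + 1) = x * Gamma x"
      using x by (intro Gamma_plus1_pos)
    moreover have "p - real s + real l = x + 1"
      by (simp add: x_def Suc)
    ultimately have G: "Gamma (p - real s + real l) = x * Gamma x"
      by simp
    have "finite_I_coeff p s l' * real (Suc m) =
          fact s * (- 1) ^ l' * Gamma p * 2 ^ Suc m / (fact l' * fact m * Gamma x)"
      using le x by (simp add: finite_I_coeff_def e x_def[symmetric] del: of_nat_Suc)
    also have "\<dots> = - A * 2 * real l * x"
      using x unfolding A_def G by (simp add: Suc del: of_nat_Suc) (simp add: mult_ac)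
    finally show ?thesis
      by (simp add: Suc e x_def)
  qed
  have key: "real m / 2 * (real m - 2 * p) - 2 * real l * (p - real s + real l - 1) =
        (real s + 1 - 2 * p) / (2 * p) * ((real s + 1) * p)"
    using p(1) unfolding s by (simp add: field_simps)
  have "A * (real m / 2) * (real m - 2 * p) + - A * 2 * real l * (p - real s + real l - 1) =
        A * (real m / 2 * (real m - 2 * p) - 2 * real l * (p - real s + real l - 1))"
    by (simp add: right_diff_distrib mult.assoc)
  also have "\<dots> = (real s + 1 - 2 * p) / (2 * p) * (A * (real s + 1) * p)"
    unfolding key by (simp only: mult_ac)
  finally show ?thesis
    unfolding upper same previous .
qed

lemma finite_I_poly_derivative:
  "(finite_I_poly p s has_real_derivative
      (\<Sum>l\<le>s. finite_I_coeff p s l * (real (s - 2 * l) * z ^ (s - 2 * l - 1)))) (at z)"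
proof -
  have "((\<lambda>z. \<Sum>l\<le>s. finite_I_coeff p s l * z ^ (s - 2 * l)) has_real_derivative
          (\<Sum>l\<le>s. finite_I_coeff p s l * (real (s - 2 * l) * z ^ (s - 2 * l - 1)))) (at z)"
    by (auto intro!: derivative_eq_intros sum.cong)
  then show ?thesis
    by (simp flip: finite_I_poly_eq_sum)
qed

lemma finite_I_poly_raising:
  assumes "real s < p - 1"
  shows "(1 + z\<^sup>2) * (\<Sum>l\<le>s. finite_I_coeff p s l * (real (s - 2 * l) * z ^ (s - 2 * l - 1))) -
           (2 * p - 1) * z * finite_I_poly p s z =
         (real s + 1 - 2 * p) / (2 * p) * finite_I_poly (p + 1) (Suc s) z"
proof -
  define a where "a = finite_I_coeff p s"
  define u where "u l = z ^ (Suc s - 2 * l)" for l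
  have "(1 + z\<^sup>2) * (\<Sum>l\<le>s. a l * (real (s - 2 * l) * z ^ (s - 2 * l - 1))) -
           (2 * p - 1) * z * finite_I_poly p s z =
        (\<Sum>l\<le>s. a l * (real (s - 2 * l) - (2 * p - 1)) * u l + a l * real (s - 2 * l) * u (Suc l))"
    unfolding finite_I_poly_eq_sum a_def[symmetric] sum_distrib_left sum_subtractf[symmetric]
  proof (intro sum.cong refl)
    fix l
    show "(1 + z\<^sup>2) * (a l * (real (s - 2 * l) * z ^ (s - 2 * l - 1))) -
            (2 * p - 1) * z * (a l * z ^ (s - 2 * l)) =
          a l * (real (s - 2 * l) - (2 * p - 1)) * u l + a l * real (s - 2 * l) * u (Suc l)"
    proof (cases "2 * l \<le> s")
      case False
      then show ?thesis
        by (simp add: a_def finite_I_coeff_def)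
    next
      case True
      then obtain e where e: "s = 2 * l + e"
        by (metis le_iff_add)
      show ?thesis
      proof (cases e)
        case 0
        then show ?thesis
          by (simp add: e u_def algebra_simps)
      next
        case (Suc e')
        then show ?thesis
          by (simp add: e u_def Suc_diff_le algebra_simps power2_eq_square)
      qed
    qed
  qed
  also have "\<dots> = (\<Sum>l\<le>s. a l * (real (s - 2 * l) - (2 * p - 1)) * u l) +
                  (\<Sum>l\<le>s. a l * real (s - 2 * l) * u (Suc l))"
    by (rule sum.distrib)
  also have "(\<Sum>l\<le>s. a l * (real (s - 2 * l) - (2 * p - 1)) * u l) =
             (\<Sum>l\<le>Suc s. a l * (real (s - 2 * l) - (2 * p - 1)) * u l)"
    by (simp add: a_def finite_I_coeff_def)
  also have "(\<Sum>l\<le>s. a l * real (s - 2 * l) * u (Suc l)) =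
             (\<Sum>l\<le>Suc s. (if l = 0 then 0 else a (l - 1) * real (s - 2 * (l - 1))) * u l)"
    by (subst sum.atMost_Suc_shift) simp
  also have "(\<Sum>l\<le>Suc s. a l * (real (s - 2 * l) - (2 * p - 1)) * u l) + \<dots> =
             (\<Sum>l\<le>Suc s. (real s + 1 - 2 * p) / (2 * p) * finite_I_coeff (p + 1) (Suc s) l * u l)"
    unfolding sum.distrib[symmetric] distrib_right[symmetric] a_def
    by (simp only: finite_I_coeff_recurrence[OF assms])
  also have "\<dots> = (real s + 1 - 2 * p) / (2 * p) * finite_I_poly (p + 1) (Suc s) z"
    unfolding finite_I_poly_eq_sum u_def by (simp only: sum_distrib_left mult.assoc)
  finally show ?thesis
    unfolding a_def .
qed

text \<open>
  Differentiating the polynomial times its weight raises both the degree and the parameter by one. It is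
  the analogue of the relation for weighted Gegenbauer polynomials with \<open>\<lambda> = 1 - p\<close>, and
  takes the place of a Rodrigues formula.
\<close>

lemma weighted_finite_I_poly_derivative:
  assumes "real s < p - 1"
  shows "((\<lambda>z. finite_I_poly p s z * (1 + z\<^sup>2) powr (- (p - 1 / 2))) has_real_derivative
           (real s + 1 - 2 * p) / (2 * p) *
           (finite_I_poly (p + 1) (Suc s) z * (1 + z\<^sup>2) powr (- (p + 1 - 1 / 2)))) (at z)"
proof -
  have pos: "1 + z\<^sup>2 > 0"
    by (intro add_pos_nonneg) auto
  define D where "D = (\<Sum>l\<le>s. finite_I_coeff p s l * (real (s - 2 * l) * z ^ (s - 2 * l - 1)))"
  define v where "v = (1 + z\<^sup>2) powr (- (p + 1 - 1 / 2))"
  have w: "(1 + z\<^sup>2) powr (- (p - 1 / 2)) = (1 + z\<^sup>2) * v"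
    using pos powr_add[of "1 + z\<^sup>2" 1 "- (p + 1 - 1 / 2)"] by (simp add: v_def)
  have "((\<lambda>z. (1 + z\<^sup>2) powr (- (p - 1 / 2))) has_real_derivative - (p - 1 / 2) * v * (2 * z)) (at z)"
  proof -
    have "((\<lambda>z. 1 + z\<^sup>2) has_real_derivative 2 * z) (at z)"
      by (auto intro!: derivative_eq_intros)
    from DERIV_fun_powr[OF this pos, of "- (p - 1 / 2)"] show ?thesis
      by (simp add: v_def algebra_simps)
  qed
  from DERIV_mult[OF finite_I_poly_derivative[of p s z, folded D_def] this]
  have "((\<lambda>z. finite_I_poly p s z * (1 + z\<^sup>2) powr (- (p - 1 / 2))) has_real_derivative
          ((1 + z\<^sup>2) * D - (2 * p - 1) * z * finite_I_poly p s z) * v) (at z)"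
    unfolding w by (rule DERIV_cong) (simp add: algebra_simps)
  then show ?thesis
    using finite_I_poly_raising[OF assms, of z] by (simp only: D_def v_def mult.assoc)
qed

lemma weighted_finite_I_poly_eq_sum:
  "z ^ n * (finite_I_poly p s z * w) = (\<Sum>l\<le>s. finite_I_coeff p s l * (z ^ (n + (s - 2 * l)) * w))"
  by (simp add: finite_I_poly_eq_sum sum_distrib_left sum_distrib_right power_add mult_ac)

text \<open>
  Only finitely many degrees are admissible, because the weight decays like a fixed power of \<open>z\<close>; this
  is the origin of the bound \<open>S < p - 1\<close>.
\<close>

lemma integrable_weighted_finite_I_poly:
  assumes "real n + real s < 2 * (p - 1)"
  shows "integrable lborel (\<lambda>z. z ^ n * (finite_I_poly p s z * (1 + z\<^sup>2) powr (- (p - 1 / 2))))"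
  unfolding weighted_finite_I_poly_eq_sum
proof (intro Bochner_Integration.integrable_sum integrable_mult_right integrable_power_times_weight)
  fix l
  have "real (n + (s - 2 * l)) \<le> real n + real s"
    by simp
  with assms show "real (n + (s - 2 * l)) < 2 * (p - 1)"
    by linarith
qed

lemma tendsto_weighted_finite_I_poly:
  assumes "real n + real s < 2 * p - 1" and "F = at_top \<or> F = at_bot"
  shows "((\<lambda>z. z ^ n * (finite_I_poly p s z * (1 + z\<^sup>2) powr (- (p - 1 / 2)))) \<longlongrightarrow> 0) F"
  unfolding weighted_finite_I_poly_eq_sum
proof (intro tendsto_null_sum tendsto_mult_right_zero tendsto_power_times_weight assms(2))
  fix l
  have "real (n + (s - 2 * l)) \<le> real n + real s"
    by simp
  with assms show "real (n + (s - 2 * l)) < 2 * p - 1"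
    by linarith
qed

text \<open>
  Integration by parts with the weighted derivative above: degree, parameter and moment order all drop
  by one, and the zeroth moment of a polynomial of positive degree vanishes.
\<close>

lemma finite_I_moment_recurrence:
  assumes "real s < p - 1" and "real n + real s < 2 * p - 1"
  shows "(2 * p - real s - 1) *
           (LBINT z. z ^ n * (finite_I_poly (p + 1) (Suc s) z * (1 + z\<^sup>2) powr (- (p + 1 - 1 / 2)))) =
         2 * p * real n *
           (LBINT z. z ^ (n - 1) * (finite_I_poly p s z * (1 + z\<^sup>2) powr (- (p - 1 / 2))))"
proof -
  define c where "c = (real s + 1 - 2 * p) / (2 * p)"
  define g where "g z = finite_I_poly p s z * (1 + z\<^sup>2) powr (- (p - 1 / 2))" for z
  define h where "h z = finite_I_poly (p + 1) (Suc s) z * (1 + z\<^sup>2) powr (- (p + 1 - 1 / 2))" for z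
  have p: "p > 1"
    using assms(1) by linarith
  have g': "(g has_real_derivative c * h z) (at z)" for z
    using weighted_finite_I_poly_derivative[OF assms(1), of z] by (simp add: g_def[abs_def] h_def c_def)
  have int_h: "integrable lborel (\<lambda>z. z ^ n * h z)"
    unfolding h_def using assms(2) by (intro integrable_weighted_finite_I_poly) simp
  have int_g: "integrable lborel (\<lambda>z. real n * (z ^ (n - 1) * g z))"
  proof (cases n)
    case (Suc m)
    then show ?thesis
      unfolding g_def using assms(2)
      by (intro integrable_mult_right integrable_weighted_finite_I_poly) simp
  qed simp
  have "(LBINT z. real n * (z ^ (n - 1) * g z) + c * (z ^ n * h z)) = 0"
  proof (rule integral_derivative_vanishing_at_infinity)
    show "((\<lambda>z. z ^ n * g z) has_real_derivative real n * (z ^ (n - 1) * g z) + c * (z ^ n * h z)) (at z)" for z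
      by (auto intro!: derivative_eq_intros g' simp: algebra_simps)
    have "1 + z\<^sup>2 \<noteq> 0" for z :: real
      using add_pos_nonneg[of 1 "z\<^sup>2"] by simp
    then show "continuous_on UNIV (\<lambda>z. real n * (z ^ (n - 1) * g z) + c * (z ^ n * h z))"
      unfolding g_def h_def finite_I_poly_eq_sum by (intro continuous_intros) auto
    show "integrable lborel (\<lambda>z. real n * (z ^ (n - 1) * g z) + c * (z ^ n * h z))"
      using int_g int_h by simp
    show "((\<lambda>z. z ^ n * g z) \<longlongrightarrow> 0) at_top" "((\<lambda>z. z ^ n * g z) \<longlongrightarrow> 0) at_bot"
      unfolding g_def using tendsto_weighted_finite_I_poly[OF assms(2)] by blast+
  qed
  then have "real n * (LBINT z. z ^ (n - 1) * g z) + c * (LBINT z. z ^ n * h z) = 0"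
    using int_g int_h by simp
  then have "2 * p * (real n * (LBINT z. z ^ (n - 1) * g z) + c * (LBINT z. z ^ n * h z)) = 0"
    by simp
  then have "2 * p * real n * (LBINT z. z ^ (n - 1) * g z) + (2 * p * c) * (LBINT z. z ^ n * h z) = 0"
    by (simp only: distrib_left mult.assoc)
  moreover have "2 * p * c = - (2 * p - real s - 1)"
    using p by (simp add: c_def)
  ultimately show ?thesis
    unfolding g_def[symmetric] h_def[symmetric]
    by (metis add_eq_0_iff minus_mult_left minus_minus)
qed

lemma finite_I_poly_0: "Gamma p \<noteq> 0 \<Longrightarrow> finite_I_poly p 0 z = 1"
  by (simp add: finite_I_poly_def)

text \<open>
  Iterating the recurrence: if \<open>n < s\<close>, the moment order reaches \<open>0\<close> while the degree is still positive,
  so the moment vanishes; if \<open>n = s\<close>, both reach \<open>0\<close> together, leaving the plain integral of the weight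
  with parameter \<open>p - s\<close>.
\<close>

lemma finite_I_moment:
  assumes "real s < p - 1" and "n \<le> s"
  shows "(LBINT z. z ^ n * (finite_I_poly p s z * (1 + z\<^sup>2) powr (- (p - 1 / 2)))) =
         (if n = s then fact s * 2 powr (2 * p - real s - 2) * Gamma p * Gamma (p - real s) /
                        ((p - real s - 1) * Gamma (2 * p - real s - 1)) else 0)"
  using assms
proof (induction s arbitrary: n p)
  case 0
  then have p: "p > 1"
    by simp
  then have G: "Gamma p > 0" "Gamma (2 * p - 2) > 0" "Gamma p = (p - 1) * Gamma (p - 1)"
    "Gamma (2 * p - 1) = (2 * p - 2) * Gamma (2 * p - 2)"
    using Gamma_plus1_pos[of "p - 1"] Gamma_plus1_pos[of "2 * p - 2"] by simp_all
  have "(LBINT z. (1 + z\<^sup>2) powr (- (p - 1 / 2))) = 2 powr (2 * p - 3) * Beta (p - 1) (p - 1)"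
    using symmetric_cauchy_weight_integral[OF p] by (simp add: has_bochner_integral_iff)
  also have "\<dots> = 2 powr (2 * p - 3) * (Gamma (p - 1) * Gamma (p - 1) / Gamma (2 * p - 2))"
    by (simp add: Beta_def)
  also have "\<dots> = 2 powr (2 * p - 2) * Gamma p * Gamma p / ((p - 1) * Gamma (2 * p - 1))"
  proof -
    have "(2::real) powr (2 * p - 2) = 2 * 2 powr (2 * p - 3)"
      using powr_add[of 2 1 "2 * p - 3"] by simp
    moreover define r where "r = p - 1"
    moreover from this have "Gamma p = r * Gamma (p - 1)" "Gamma (2 * p - 1) = 2 * r * Gamma (2 * p - 2)" "r > 0"
      using p by (simp_all only: G(3,4)) simp_all
    ultimately show ?thesis
      by (simp only: r_def[symmetric]) simp
  qed
  finally show ?case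
    using 0 finite_I_poly_0[OF less_imp_neq[OF G(1), symmetric]] by simp
next
  case (Suc s)
  define P where "P = p - 1"
  have p: "p = P + 1" and P: "real s < P - 1"
    using Suc.prems by (auto simp: P_def)
  have c: "2 * P - real s - 1 > 0"
    using P by linarith
  have "real n + real s < 2 * P - 1"
    using Suc.prems P by linarith
  from finite_I_moment_recurrence[OF P this]
  have rec: "(2 * P - real s - 1) *
      (LBINT z. z ^ n * (finite_I_poly p (Suc s) z * (1 + z\<^sup>2) powr (- (p - 1 / 2)))) =
      2 * P * real n * (LBINT z. z ^ (n - 1) * (finite_I_poly P s z * (1 + z\<^sup>2) powr (- (P - 1 / 2))))"
    unfolding p .
  show ?case
  proof (cases n)
    case 0
    then show ?thesis
      using rec c by simp
  next
    case (Suc m)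
    then have m: "m \<le> s"
      using \<open>n \<le> Suc s\<close> by simp
    show ?thesis
    proof (cases "m = s")
      case False
      then show ?thesis
        using rec c Suc.IH[OF P m] Suc by simp
    next
      case True
      define K where "K = fact s * 2 powr (2 * P - real s - 2) * Gamma P * Gamma (P - real s) /
                          ((P - real s - 1) * Gamma (2 * P - real s - 1))"
      have "(2 * P - real s - 1) *
        (LBINT z. z ^ n * (finite_I_poly p (Suc s) z * (1 + z\<^sup>2) powr (- (p - 1 / 2)))) =
        2 * P * real (Suc s) * K"
        using rec Suc.IH[OF P m] Suc True by (simp add: K_def)
      then have "(LBINT z. z ^ n * (finite_I_poly p (Suc s) z * (1 + z\<^sup>2) powr (- (p - 1 / 2)))) =
        2 * P * real (Suc s) * K / (2 * P - real s - 1)"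
        using c by (simp add: field_simps)
      also have "\<dots> = fact (Suc s) * 2 powr (2 * p - real (Suc s) - 2) * Gamma p * Gamma (p - real (Suc s)) /
                        ((p - real (Suc s) - 1) * Gamma (2 * p - real (Suc s) - 1))"
      proof -
        have 1: "Gamma p = P * Gamma P"
          unfolding p using P by (intro Gamma_plus1_pos) linarith
        have "Gamma (2 * P - real s - 1 + 1) = (2 * P - real s - 1) * Gamma (2 * P - real s - 1)"
          using c by (intro Gamma_plus1_pos)
        then have 2: "Gamma (2 * p - real (Suc s) - 1) = (2 * P - real s - 1) * Gamma (2 * P - real s - 1)"
          by (simp add: p)
        have 3: "(2::real) powr (2 * p - real (Suc s) - 2) = 2 * 2 powr (2 * P - real s - 2)"
          using powr_add[of 2 1 "2 * P - real s - 2"] by (simp add: p algebra_simps)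
        have 4: "p - real (Suc s) = P - real s"
          by (simp add: p)
        show ?thesis
          unfolding 1 2 3 4 K_def by (simp add: field_simps)
      qed
      finally show ?thesis
        using Suc True by simp
    qed
  qed
qed

section \<open>Biorthogonality of the bivariate polynomials\<close>

text \<open>
  The first set has the same coefficients in \<open>z\<close> as the univariate finite polynomial; the term with index
  \<open>l\<close> carries the Konhauser polynomial with index \<open>k - l\<close>. The prefactors match because \<open>(- 1) ^ k * pochhammer (1 - p) k = pochhammer (p - k) k\<close>.
\<close>

lemma konhauser_I_first_eq_sum:
  assumes "real k < p - 1"
  shows "konhauser_I_first p q \<upsilon> k z t =
         (\<Sum>l\<le>k. finite_I_coeff p k l * z ^ (k - 2 * l) * konhauser_Z q \<upsilon> (k - l) t)"
proof -
  have pos: "p - real k > 0" "Gamma (p - real k) > 0"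
    using assms by auto
  have shift: "pochhammer (p - real k) l = Gamma (p - real k + real l) / Gamma (p - real k)" for l
    using pos by (intro pochhammer_Gamma) (auto elim!: nonpos_Ints_cases)
  have outer: "(- 1) ^ k * pochhammer (1 - p) k = Gamma p / Gamma (p - real k)"
    using pochhammer_minus'[of "p - 1" k] shift[of k] by (simp add: algebra_simps)
  have "konhauser_I_first p q \<upsilon> k z t =
        (\<Sum>l=0..k div 2. finite_I_coeff p k l * z ^ (k - 2 * l) * konhauser_Z q \<upsilon> (k - l) t)"
    unfolding konhauser_I_first_def sum_distrib_left
  proof (intro sum.cong refl)
    fix l assume "l \<in> {0..k div 2}"
    then have l: "2 * l \<le> k" by auto
    have "pochhammer (- real k) (2 * l) = fact (2 * l) * real (k choose (2 * l))"
      using pochhammer_minus_nat_div_fact[of k "2 * l"] by (simp add: field_simps)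
    also have "\<dots> = fact k / fact (k - 2 * l)"
      using l by (simp add: binomial_fact)
    finally have falling: "pochhammer (- real k) (2 * l) = fact k / fact (k - 2 * l)" .
    have arg: "real l - real k = - real (k - l)"
      using l by simp
    have coeff: "finite_I_coeff p k l * z ^ (k - 2 * l) =
          Gamma p / Gamma (p - real k) * ((- 1) ^ l * pochhammer (- real k) (2 * l) * (2 * z) ^ (k - 2 * l) /
            (pochhammer (p - real k) l * fact l))"
      using l less_imp_neq[OF pos(2)] unfolding falling shift finite_I_coeff_def
      by (simp add: power_mult_distrib) (simp add: mult_ac)
    show "(\<Sum>n=0..k - l. (- 1) ^ k * pochhammer (1 - p) k *
            ((- 1) ^ l * pochhammer (- real k) (2 * l) * pochhammer (real l - real k) n *
             (2 * z) ^ (k - 2 * l) * t ^ (\<upsilon> * n) /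
             (pochhammer (p - real k) l * Gamma (real \<upsilon> * real n + q + 1) * fact n * fact l))) =
          finite_I_coeff p k l * z ^ (k - 2 * l) * konhauser_Z q \<upsilon> (k - l) t"
      unfolding coeff outer konhauser_Z_def sum_distrib_left atLeast0AtMost arg
      by (intro sum.cong refl) (simp add: mult_ac)
  qed
  also have "\<dots> = (\<Sum>l\<le>k. finite_I_coeff p k l * z ^ (k - 2 * l) * konhauser_Z q \<upsilon> (k - l) t)"
    by (intro sum.mono_neutral_left) (auto simp: finite_I_coeff_def)
  finally show ?thesis .
qed

text \<open>
  The sum of all \<open>Y\<close> up to index \<open>s\<close> pairs to \<open>1\<close> with the \<open>Z\<close> of index \<open>k - l\<close> if \<open>k - l \<le> s\<close>, and to \<open>0\<close>
  otherwise. Integrating out \<open>t\<close> thus only truncates the univariate polynomial of degree \<open>k\<close>.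
\<close>

lemma konhauser_inner_integral:
  fixes p q :: real
  assumes "q > - 1" and "\<upsilon> \<ge> 1" and "real k < p - 1"
  shows "has_bochner_integral lborel
           (\<lambda>t. indicator {0<..} t *
              (konhauser_I_first p q \<upsilon> k z t * konhauser_I_second p q \<upsilon> s z t * exp (- t) * t powr q * w))
           (\<Sum>l\<le>k. finite_I_coeff p k l * (if k - l \<le> s then 1 else 0) *
              (z ^ (k - 2 * l) * (finite_I_poly p s z * w)))"
proof -
  define C where "C l = finite_I_coeff p k l * z ^ (k - 2 * l) * finite_I_poly p s z * w" for l
  have *: "indicator {0<..} t *
             (konhauser_I_first p q \<upsilon> k z t * konhauser_I_second p q \<upsilon> s z t * exp (- t) * t powr q * w) =
           (\<Sum>l\<le>k. C l * (\<Sum>j\<le>s. indicator {0<..} t *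
              (konhauser_Z q \<upsilon> (k - l) t * konhauser_Y q \<upsilon> j t * exp (- t) * t powr q)))" for t
    unfolding konhauser_I_first_eq_sum[OF assms(3)] konhauser_I_second_def atLeast0AtMost C_def
    by (simp add: sum_distrib_left sum_distrib_right mult_ac)
  have "has_bochner_integral lborel
          (\<lambda>t. \<Sum>l\<le>k. C l * (\<Sum>j\<le>s. indicator {0<..} t *
              (konhauser_Z q \<upsilon> (k - l) t * konhauser_Y q \<upsilon> j t * exp (- t) * t powr q)))
          (\<Sum>l\<le>k. C l * (\<Sum>j\<le>s. if k - l = j then 1 else 0))"
    by (intro has_bochner_integral_sum has_bochner_integral_mult_right konhauser_biorthonormality assms)
  also have "(\<Sum>l\<le>k. C l * (\<Sum>j\<le>s. if k - l = j then 1 else 0)) =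
             (\<Sum>l\<le>k. finite_I_coeff p k l * (if k - l \<le> s then 1 else 0) *
              (z ^ (k - 2 * l) * (finite_I_poly p s z * w)))"
    by (intro sum.cong refl) (simp add: C_def)
  finally show ?thesis
    by (simp only: *)
qed

theorem theorem8:
  fixes \<upsilon> S s k :: nat and p q :: real
  assumes "\<upsilon> \<ge> 1" and "q > - 1" and "real S < p - 1"
    and "s \<in> {0..S}" and "k \<in> {0..S}"
  shows "let F = (\<lambda>z t. konhauser_I_first p q \<upsilon> k z t * konhauser_I_second p q \<upsilon> s z t *
                        exp (- t) * t powr q * (1 + z\<^sup>2) powr (- (p - 1 / 2)))
         in (\<forall>z. set_integrable lborel {0<..} (F z)) \<and>
            integrable lborel (\<lambda>z. LBINT t:{0<..}. F z t) \<and>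
            (LBINT z. (LBINT t:{0<..}. F z t)) =
              fact k * 2 powr (2 * (p - 1)) * (Gamma p)\<^sup>2 /
              ((p - real k - 1) * Gamma (2 * p - real k - 1)) * (if k = s then 1 else 0)"
proof -
  have k: "real k < p - 1" and s: "real s < p - 1"
    using assms by auto
  define F where "F = (\<lambda>z t. konhauser_I_first p q \<upsilon> k z t * konhauser_I_second p q \<upsilon> s z t *
                        exp (- t) * t powr q * (1 + z\<^sup>2) powr (- (p - 1 / 2)))"
  define M where "M n z = z ^ n * (finite_I_poly p s z * (1 + z\<^sup>2) powr (- (p - 1 / 2)))" for n z
  define b where "b l = finite_I_coeff p k l * (if k - l \<le> s then 1 else 0)" for l
  have inner: "has_bochner_integral lborel (\<lambda>t. indicator {0<..} t * F z t) (\<Sum>l\<le>k. b l * M (k - 2 * l) z)" for z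
    unfolding F_def M_def b_def using konhauser_inner_integral[OF assms(2,1) k] .
  have F_integrable: "set_integrable lborel {0<..} (F z)" for z
    using inner[of z] by (simp add: set_integrable_def has_bochner_integral_iff)
  have F_inner: "(LBINT t:{0<..}. F z t) = (\<Sum>l\<le>k. b l * M (k - 2 * l) z)" for z
    using inner[of z] by (simp add: set_lebesgue_integral_def has_bochner_integral_iff)
  have M_integrable: "integrable lborel (M (k - 2 * l))" for l
  proof -
    have "real (k - 2 * l) < p - 1"
      using k by (rule le_less_trans[rotated]) simp
    from add_strict_mono[OF this s] have "real (k - 2 * l) + real s < 2 * (p - 1)"
      by (simp only: mult_2)
    then show ?thesis
      unfolding M_def by (rule integrable_weighted_finite_I_poly)
  qed
  have "(LBINT z. (\<Sum>l\<le>k. b l * M (k - 2 * l) z)) = (\<Sum>l\<le>k. b l * (LBINT z. M (k - 2 * l) z))"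
    using M_integrable by simp
  also have "\<dots> = (\<Sum>l\<le>k. if l = 0 then b 0 * (LBINT z. M k z) else 0)"
  proof (intro sum.cong refl)
    \<comment> \<open>A term that survives the truncation has \<open>k - 2 * l \<le> s - l\<close>, so for \<open>l > 0\<close> its power of \<open>z\<close>
      is below \<open>s\<close> and integrates to \<open>0\<close>.\<close>
    fix l assume l: "l \<in> {..k}"
    show "b l * (LBINT z. M (k - 2 * l) z) = (if l = 0 then b 0 * (LBINT z. M k z) else 0)"
    proof (cases "l = 0 \<or> 2 * l > k \<or> k - l > s")
      case True
      then show ?thesis
        by (auto simp: b_def finite_I_coeff_def)
    next
      case False
      then have "k - 2 * l < s" by auto
      then show ?thesis
        using finite_I_moment[OF s, of "k - 2 * l"] False by (simp add: M_def)
    qed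
  qed
  also have "\<dots> = b 0 * (LBINT z. M k z)"
    by simp
  also have "\<dots> = fact k * 2 powr (2 * (p - 1)) * (Gamma p)\<^sup>2 /
              ((p - real k - 1) * Gamma (2 * p - real k - 1)) * (if k = s then 1 else 0)"
  proof (cases "k = s")
    case False
    then show ?thesis
      using finite_I_moment[OF s, of k] by (auto simp: b_def M_def)
  next
    case True
    have G: "Gamma (p - real k) > 0"
      using k by (intro Gamma_real_pos) simp
    have "b 0 = Gamma p * 2 ^ k / Gamma (p - real k)"
      using True by (simp add: b_def finite_I_coeff_def)
    moreover have "(LBINT z. M k z) = fact k * 2 powr (2 * p - real k - 2) * Gamma p * Gamma (p - real k) /
                        ((p - real k - 1) * Gamma (2 * p - real k - 1))"
      unfolding M_def using finite_I_moment[OF s, of k] True by simp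
    moreover have "(2::real) powr (2 * (p - 1)) = 2 ^ k * 2 powr (2 * p - real k - 2)"
      using powr_add[of 2 "real k" "2 * p - real k - 2"] by (simp add: powr_realpow algebra_simps)
    ultimately show ?thesis
      using G True by (simp add: power2_eq_square)
  qed
  finally have "(LBINT z. (\<Sum>l\<le>k. b l * M (k - 2 * l) z)) = fact k * 2 powr (2 * (p - 1)) * (Gamma p)\<^sup>2 /
              ((p - real k - 1) * Gamma (2 * p - real k - 1)) * (if k = s then 1 else 0)" .
  moreover have "integrable lborel (\<lambda>z. \<Sum>l\<le>k. b l * M (k - 2 * l) z)"
    using M_integrable by simp
  ultimately show ?thesis
    unfolding Let_def F_def[symmetric] F_inner using F_integrable by blast
qed

end
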